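(* Let $F=(F_1,\dots,F_m):\mathbb{R}^n\to\mathbb{R}^m$ be continuously differentiable, and suppose that for any $x^0\in\mathbb{R}^n$ the level set $\mathcal{L}_F(x^0)=\{x\in\mathbb{R}^n: F_i(x)\le F_i(x^0)\ \text{for all } i\in[m]\}$ is compact. Let $\{x^k\}$ be an infinite sequence of non-Pareto-critical points generated, from a starting point $x^0$, by the subspace minimization Barzilai-Borwein descent method (SMBBMO) described in the context. Then $\{x^k\}$ has at least one accumulation point, and every accumulation point $x^*\in\mathcal{L}_F(x^0)$ is a Pareto critical point.
   Context: Notation: $[m]=\{1,\dots,m\}$; $\Delta_m=\{\lambda\in\mathbb{R}^m:\lambda_i\ge0,\ \sum_i\lambda_i=1\}$; for $\alpha\in\mathbb{R}^m$ with positive entries, $\mathcal{D}_\alpha(x,d)=\max_{i\in[m]}\langle\nabla F_i(x)/\alpha_i,d\rangle$. A point $x^*$ is Pareto critical if there is no $d\in\mathbb{R}^n$ with $\langle\nabla F_i(x^* ),d\rangle<0$ for all $i\in[m]$. Parameters of SMBBMO: $0<c_1\le c_2$, $0<\sigma_1\le\sigma_2<1$, $0<\alpha_{\min}<\alpha_{\max}$, a starting point $x^0$ and an auxiliary point $x^{-1}$ near $x^0$. Write $s_{k-1}=x^k-x^{k-1}$ and $y_i^{k-1}=\nabla F_i(x^k)-\nabla F_i(x^{k-1})$. Iteration $k=0,1,2,\dots$: (1) Set $\alpha_i^k=\max\{\alpha_{\min},\min\{\langle s_{k-1},y_i^{k-1}\rangle/\|s_{k-1}\|^2,\alpha_{\max}\}\}$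 if $\langle s_{k-1},y_i^{k-1}\rangle>0$; $\alpha_i^k=\max\{\alpha_{\min},\min\{\|y_i^{k-1}\|/\|s_{k-1}\|,\alpha_{\max}\}\}$ if $\langle s_{k-1},y_i^{k-1}\rangle<0$; $\alpha_i^k=\alpha_{\min}$ if $\langle s_{k-1},y_i^{k-1}\rangle=0$. (2) Compute $v_k=\arg\min_{v\in\mathbb{R}^n}\max_{i\in[m]}\{\langle\nabla F_i(x^k),v\rangle/\alpha_i^k+\frac12\|v\|^2\}$ and a dual solution $\lambda^k\in\Delta_m$ (vector of KKT multipliers of the $m$ inequality constraints in the epigraph reformulation). If $v_k=0$, stop ($x^k$ is Pareto critical). (3) If $k=0$, set $d_0=v_0$, $\bar\lambda^0=\lambda^0$, $\bar\alpha^0=\alpha^0$. (4) If $k\ge1$, set $$y^{k-1}=\sum_{i}\tfrac{\bar\lambda_i^{k-1}}{\bar\alpha_i^{k-1}}(\nabla F_i(x^k)-\nabla F_i(x^{k-1})),\qquad y_v^{k-1}=\sum_i\tfrac{\bar\lambda_i^{k-1}}{\bar\alpha_i^{k-1}}(\nabla F_i(x^k)-\nabla F_i(x^k-v_k)).$$ Set $\rho_1^k=\langle v_k,y_v^{k-1}\rangle$ if this is positive and $\rho_1^k=\|v_k\|\|y_v^{k-1}\|$ otherwise. Set $\rho_2^k=\langle s_{k-1},y^{k-1}\rangle$ if this is positive and $\rho_2^k=\mathcal{D}_{\bar\alpha^{k-1}}(x^k,s_{k-1})-\sum_i\bar\lambda_i^{k-1}\langle\nabla F_i(x^{k-1})/\bar\alpha_i^{k-1},s_{k-1}\rangle$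 otherwise (the Wolfe conditions in (5) ensure $\rho_2^k>0$). The matrix $H^k$ is obtained by a modified Cholesky factorization: let $D_k=\mathrm{diag}(\|v_k\|,\|s_{k-1}\|)$ and $\hat H=D_k^{-1}\begin{pmatrix}\rho_1^k&\langle v_k,y^{k-1}\rangle\\ \langle v_k,y^{k-1}\rangle&\rho_2^k\end{pmatrix}D_k^{-1}$. Let $L$ be the lower triangular $2\times2$ matrix with $L_{11}=\sqrt{\hat H_{11}}$ if $\sqrt{\hat H_{11}}>c_1$ and $L_{11}=\sqrt{c_2}$ otherwise; $L_{21}=\hat H_{21}/L_{11}$; $L_{22}=\sqrt{\hat H_{22}-L_{21}^2}$ if $\hat H_{22}-L_{21}^2>c_1$ and $L_{22}=\sqrt{c_2}$ otherwise. Set $H^k=D_kLL^TD_k$. It is understood that this procedure yields matrices satisfying $$c_1\le\lambda_{\min}(D_k^{-1}H^kD_k^{-1})\le\lambda_{\max}(D_k^{-1}H^kD_k^{-1})\le c_2\quad\text{for all }k\ge1.$$ Set $\bar\alpha_i^k=\max\{\alpha_{\min},\min\{\langle s_{k-1},y_i^{k-1}\rangle/\rho_2^k,\alpha_{\max}\}\}$ if $\langle s_{k-1},y_i^{k-1}\rangle>0$; $\bar\alpha_i^k=\max\{\alpha_{\min},\min\{\|y_i^{k-1}\|/\|y^{k-1}\|,\alpha_{\max}\}\}$ if $\langle s_{k-1},y_i^{k-1}\rangle<0$; $\bar\alpha_i^k=\alpha_{\min}$ if $\langle s_{k-1},y_i^{k-1}\rangle=0$. Let $(\mu_k,\nu_k)^T\in\mathbb{R}^2$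 and $\bar\lambda^k\in\Delta_m$ be the solution and a dual solution (in the same sense as in (2)) of $$\min_{(\mu,\nu)^T\in\mathbb{R}^2}\max_{i\in[m]}\left\{\mu\langle\nabla F_i(x^k)/\bar\alpha_i^k,v_k\rangle+\nu\langle\nabla F_i(x^k)/\bar\alpha_i^k,s_{k-1}\rangle\right\}+\frac12\left\langle\begin{pmatrix}\mu\\ \nu\end{pmatrix},H^k\begin{pmatrix}\mu\\ \nu\end{pmatrix}\right\rangle,$$ and set $d_k=\mu_kv_k+\nu_ks_{k-1}$. (5) Choose a stepsize $t=t_k>0$ satisfying the Wolfe conditions $$(F_i(x^k+td_k)-F_i(x^k))/\bar\alpha_i^k\le\sigma_1t\,\mathcal{D}_{\bar\alpha^k}(x^k,d_k)\ \ \forall i\in[m],\qquad \mathcal{D}_{\bar\alpha^k}(x^k+td_k,d_k)\ge\sigma_2\mathcal{D}_{\bar\alpha^k}(x^k,d_k),$$ and set $x^{k+1}=x^k+t_kd_k$. *)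

theory Defs
  imports "HOL-Analysis.Analysis"
begin

text \<open>The objective is \<open>F :: real^'n \<Rightarrow> real^'m\<close>, with components \<open>F x $ i\<close>.\<close>

definition grad :: "(real^'n \<Rightarrow> real^'m) \<Rightarrow> 'm \<Rightarrow> real^'n \<Rightarrow> real^'n" where
  "grad F i x = (THE g. GDERIV (\<lambda>z. F z $ i) x :> g)"

definition continuously_differentiable :: "(real^'n \<Rightarrow> real^'m) \<Rightarrow> bool" where
  "continuously_differentiable F \<longleftrightarrow>
     (\<forall>x. F differentiable (at x)) \<and> (\<forall>i. continuous_on UNIV (grad F i))"

definition level_set :: "(real^'n \<Rightarrow> real^'m) \<Rightarrow> real^'n \<Rightarrow> (real^'n) set" where
  "level_set F x0 = {x. \<forall>i. F x $ i \<le> F x0 $ i}"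

definition pareto_critical :: "(real^'n \<Rightarrow> real^'m) \<Rightarrow> real^'n \<Rightarrow> bool" where
  "pareto_critical F x \<longleftrightarrow> \<not> (\<exists>d. \<forall>i. grad F i x \<bullet> d < 0)"

definition accumulation_point :: "(nat \<Rightarrow> real^'n) \<Rightarrow> real^'n \<Rightarrow> bool" where
  "accumulation_point x l \<longleftrightarrow> (\<exists>r :: nat \<Rightarrow> nat. strict_mono r \<and> (x \<circ> r) \<longlonglongrightarrow> l)"

definition Dmax :: "(real^'n \<Rightarrow> real^'m) \<Rightarrow> real^'m \<Rightarrow> real^'n \<Rightarrow> real^'n \<Rightarrow> real" where
  "Dmax F \<alpha> x d = (MAX i. (grad F i x /\<^sub>R \<alpha> $ i) \<bullet> d)"


definition unit_simplex :: "(real^'m) set" where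
  "unit_simplex = {lam. (\<forall>i. 0 \<le> lam $ i) \<and> (\<Sum>i\<in>UNIV. lam $ i) = 1}"

text \<open>KKT conditions at \<open>z\<close> for minimizing \<open>f\<close> subject to \<open>g i z \<le> 0\<close> for all \<open>i\<close>.\<close>

definition kkt_multipliers ::
    "('a::real_inner \<Rightarrow> real) \<Rightarrow> ('m::finite \<Rightarrow> 'a \<Rightarrow> real) \<Rightarrow> 'a \<Rightarrow> real^'m \<Rightarrow> bool" where
  "kkt_multipliers f g z lam \<longleftrightarrow>
     (\<forall>i. g i z \<le> 0) \<and> (\<forall>i. 0 \<le> lam $ i) \<and> (\<forall>i. lam $ i * g i z = 0) \<and>
     GDERIV (\<lambda>w. f w + (\<Sum>i\<in>UNIV. lam $ i * g i w)) z :> 0"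

text \<open>Dual solution of minimizing \<open>(MAX i. p i z) + q z\<close>: multipliers of the epigraph
  reformulation, which minimizes \<open>\<tau> + q z\<close> over pairs \<open>(\<tau>, z)\<close> subject to \<open>p i z \<le> \<tau>\<close> for all \<open>i\<close>,
  taken at its solution \<open>(MAX i. p i z, z)\<close>.\<close>

definition dual_solution ::
    "('m::finite \<Rightarrow> 'a::real_inner \<Rightarrow> real) \<Rightarrow> ('a \<Rightarrow> real) \<Rightarrow> 'a \<Rightarrow> real^'m \<Rightarrow> bool" where
  "dual_solution p q z lam \<longleftrightarrow> lam \<in> unit_simplex \<and>
     kkt_multipliers (\<lambda>w. fst w + q (snd w)) (\<lambda>i w. p i (snd w) - fst w) (MAX i. p i z, z) lam"


definition mat2 :: "real \<Rightarrow> real \<Rightarrow> real \<Rightarrow> real \<Rightarrow> real^2^2" where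
  "mat2 a b c d = vector [vector [a, b], vector [c, d]]"

definition eigenvalues :: "real^'k^'k \<Rightarrow> real set" where
  "eigenvalues A = {e. \<exists>w. w \<noteq> 0 \<and> A *v w = e *\<^sub>R w}"

text \<open>Only used for symmetric matrices, whose set of real eigenvalues is finite and nonempty.\<close>

definition lambda_min :: "real^'k^'k \<Rightarrow> real" where
  "lambda_min A = Min (eigenvalues A)"

definition lambda_max :: "real^'k^'k \<Rightarrow> real" where
  "lambda_max A = Max (eigenvalues A)"

definition modified_cholesky :: "real \<Rightarrow> real \<Rightarrow> real^2^2 \<Rightarrow> real^2^2" where
  "modified_cholesky c1 c2 A =
     (let L11 = (if sqrt (A $ 1 $ 1) > c1 then sqrt (A $ 1 $ 1) else sqrt c2);
          L21 = A $ 2 $ 1 / L11;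
          L22 = (if A $ 2 $ 2 - L21\<^sup>2 > c1 then sqrt (A $ 2 $ 2 - L21\<^sup>2) else sqrt c2)
      in mat2 L11 0 L21 L22)"

definition scaling :: "real^'n \<Rightarrow> real^'n \<Rightarrow> real^2^2" where
  "scaling v s = mat2 (norm v) 0 0 (norm s)"

definition hessian_approx ::
    "real \<Rightarrow> real \<Rightarrow> real^'n \<Rightarrow> real^'n \<Rightarrow> real^'n \<Rightarrow> real \<Rightarrow> real \<Rightarrow> real^2^2" where
  "hessian_approx c1 c2 v s y \<rho>1 \<rho>2 =
     (let D = scaling v s;
          A = matrix_inv D ** mat2 \<rho>1 (v \<bullet> y) (v \<bullet> y) \<rho>2 ** matrix_inv D;
          L = modified_cholesky c1 c2 A
      in D ** L ** transpose L ** D)"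


text \<open>\<open>step xm1 x k\<close> is $s_{k-1} = x^k - x^{k-1}$, where \<open>xm1\<close> is the auxiliary point $x^{-1}$.\<close>

definition prev :: "real^'n \<Rightarrow> (nat \<Rightarrow> real^'n) \<Rightarrow> nat \<Rightarrow> real^'n" where
  "prev xm1 x k = (case k of 0 \<Rightarrow> xm1 | Suc j \<Rightarrow> x j)"

definition step :: "real^'n \<Rightarrow> (nat \<Rightarrow> real^'n) \<Rightarrow> nat \<Rightarrow> real^'n" where
  "step xm1 x k = x k - prev xm1 x k"

definition bb_alpha :: "real \<Rightarrow> real \<Rightarrow> real^'n \<Rightarrow> real^'n \<Rightarrow> real" where
  "bb_alpha \<alpha>min \<alpha>max s yi =
     (if s \<bullet> yi > 0 then max \<alpha>min (min (s \<bullet> yi / (norm s)\<^sup>2) \<alpha>max)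
      else if s \<bullet> yi < 0 then max \<alpha>min (min (norm yi / norm s) \<alpha>max)
      else \<alpha>min)"

definition bb_alpha_bar ::
    "real \<Rightarrow> real \<Rightarrow> real \<Rightarrow> real^'n \<Rightarrow> real^'n \<Rightarrow> real^'n \<Rightarrow> real" where
  "bb_alpha_bar \<alpha>min \<alpha>max \<rho>2 y s yi =
     (if s \<bullet> yi > 0 then max \<alpha>min (min (s \<bullet> yi / \<rho>2) \<alpha>max)
      else if s \<bullet> yi < 0 then max \<alpha>min (min (norm yi / norm y) \<alpha>max)
      else \<alpha>min)"

definition weighted_grad_diff ::
    "(real^'n \<Rightarrow> real^'m) \<Rightarrow> real^'m \<Rightarrow> real^'m \<Rightarrow> real^'n \<Rightarrow> real^'n \<Rightarrow> real^'n" where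
  "weighted_grad_diff F lam \<alpha> x z =
     (\<Sum>i\<in>UNIV. (lam $ i / \<alpha> $ i) *\<^sub>R (grad F i x - grad F i z))"

definition rho1 :: "real^'n \<Rightarrow> real^'n \<Rightarrow> real" where
  "rho1 v yv = (if v \<bullet> yv > 0 then v \<bullet> yv else norm v * norm yv)"

text \<open>Here \<open>x\<close>, \<open>z\<close> are the current and the previous iterate, \<open>s = x - z\<close>, and \<open>lam\<close>, \<open>\<alpha>\<close> are
  the multipliers and scalings of the previous iteration.\<close>

definition rho2 ::
    "(real^'n \<Rightarrow> real^'m) \<Rightarrow> real^'m \<Rightarrow> real^'m \<Rightarrow> real^'n \<Rightarrow> real^'n \<Rightarrow> real^'n \<Rightarrow> real^'n \<Rightarrow> real" where
  "rho2 F lam \<alpha> x z s y =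
     (if s \<bullet> y > 0 then s \<bullet> y
      else Dmax F \<alpha> x s - (\<Sum>i\<in>UNIV. lam $ i * ((grad F i z /\<^sub>R \<alpha> $ i) \<bullet> s)))"

definition wolfe ::
    "(real^'n \<Rightarrow> real^'m) \<Rightarrow> real \<Rightarrow> real \<Rightarrow> real^'m \<Rightarrow> real^'n \<Rightarrow> real^'n \<Rightarrow> real \<Rightarrow> bool" where
  "wolfe F \<sigma>1 \<sigma>2 \<alpha> x d t \<longleftrightarrow>
     (\<forall>i. (F (x + t *\<^sub>R d) $ i - F x $ i) / \<alpha> $ i \<le> \<sigma>1 * t * Dmax F \<alpha> x d) \<and>
     Dmax F \<alpha> (x + t *\<^sub>R d) d \<ge> \<sigma>2 * Dmax F \<alpha> x d"

definition direction_subproblem ::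
    "(real^'n \<Rightarrow> real^'m) \<Rightarrow> real^'m \<Rightarrow> real^'n \<Rightarrow> real^'n \<Rightarrow> real^'m \<Rightarrow> bool" where
  "direction_subproblem F \<alpha> x v lam \<longleftrightarrow>
     is_arg_min (\<lambda>u. MAX i. (grad F i x /\<^sub>R \<alpha> $ i) \<bullet> u + (norm u)\<^sup>2 / 2) (\<lambda>_. True) v \<and>
     dual_solution (\<lambda>i u. (grad F i x /\<^sub>R \<alpha> $ i) \<bullet> u) (\<lambda>u. (norm u)\<^sup>2 / 2) v lam"

definition subspace_subproblem ::
    "(real^'n \<Rightarrow> real^'m) \<Rightarrow> real^'m \<Rightarrow> real^'n \<Rightarrow> real^'n \<Rightarrow> real^'n \<Rightarrow> real^2^2 \<Rightarrow>
     real \<Rightarrow> real \<Rightarrow> real^'m \<Rightarrow> bool" where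
  "subspace_subproblem F \<alpha> x v s H \<mu> \<nu> lam \<longleftrightarrow>
     (let p = (\<lambda>i (w :: real^2). w $ 1 * ((grad F i x /\<^sub>R \<alpha> $ i) \<bullet> v)
                               + w $ 2 * ((grad F i x /\<^sub>R \<alpha> $ i) \<bullet> s));
          q = (\<lambda>w. (w \<bullet> (H *v w)) / 2)
      in is_arg_min (\<lambda>w. (MAX i. p i w) + q w) (\<lambda>_. True) (vector [\<mu>, \<nu>]) \<and>
         dual_solution p q (vector [\<mu>, \<nu>]) lam)"

text \<open>An infinite (never stopping) run of the method. Barred quantities carry a suffix \<open>b\<close>; the
  values of \<open>H\<close>, \<open>\<mu>\<close>, \<open>\<nu>\<close> at index \<open>0\<close> are irrelevant.\<close>

definition smbbmo ::
    "(real^'n \<Rightarrow> real^'m) \<Rightarrow> real \<Rightarrow> real \<Rightarrow> real \<Rightarrow> real \<Rightarrow> real \<Rightarrow> real \<Rightarrow>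
     real^'n \<Rightarrow> (nat \<Rightarrow> real^'n) \<Rightarrow>
     (nat \<Rightarrow> real^'m) \<Rightarrow> (nat \<Rightarrow> real^'n) \<Rightarrow> (nat \<Rightarrow> real^'m) \<Rightarrow>
     (nat \<Rightarrow> real^2^2) \<Rightarrow> (nat \<Rightarrow> real^'m) \<Rightarrow> (nat \<Rightarrow> real) \<Rightarrow> (nat \<Rightarrow> real) \<Rightarrow> (nat \<Rightarrow> real^'m) \<Rightarrow>
     (nat \<Rightarrow> real^'n) \<Rightarrow> (nat \<Rightarrow> real) \<Rightarrow> bool" where
  "smbbmo F c1 c2 \<sigma>1 \<sigma>2 \<alpha>min \<alpha>max xm1 x \<alpha> v lam H \<alpha>b \<mu> \<nu> lamb d t \<longleftrightarrow>
     (\<forall>k. \<alpha> k = (\<chi> i. bb_alpha \<alpha>min \<alpha>max (step xm1 x k)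
                          (grad F i (x k) - grad F i (prev xm1 x k)))) \<and>
     (\<forall>k. direction_subproblem F (\<alpha> k) (x k) (v k) (lam k)) \<and>
     (\<forall>k. v k \<noteq> 0) \<and>
     d 0 = v 0 \<and> lamb 0 = lam 0 \<and> \<alpha>b 0 = \<alpha> 0 \<and>
     (\<forall>k\<ge>1.
        (let s = step xm1 x k;
             y = weighted_grad_diff F (lamb (k - 1)) (\<alpha>b (k - 1)) (x k) (x (k - 1));
             yv = weighted_grad_diff F (lamb (k - 1)) (\<alpha>b (k - 1)) (x k) (x k - v k);
             \<rho>1 = rho1 (v k) yv;
             \<rho>2 = rho2 F (lamb (k - 1)) (\<alpha>b (k - 1)) (x k) (x (k - 1)) s y
         in H k = hessian_approx c1 c2 (v k) s y \<rho>1 \<rho>2 \<and>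
            \<alpha>b k = (\<chi> i. bb_alpha_bar \<alpha>min \<alpha>max \<rho>2 y s (grad F i (x k) - grad F i (x (k - 1)))) \<and>
            subspace_subproblem F (\<alpha>b k) (x k) (v k) s (H k) (\<mu> k) (\<nu> k) (lamb k) \<and>
            d k = \<mu> k *\<^sub>R v k + \<nu> k *\<^sub>R s)) \<and>
     (\<forall>k. t k > 0 \<and> wolfe F \<sigma>1 \<sigma>2 (\<alpha>b k) (x k) (d k) (t k) \<and>
          x (Suc k) = x k + t k *\<^sub>R d k)"

end

theory Submission
  imports Defs
begin

text \<open>Why the theorem holds. Write \<open>D k = Dmax F (\<alpha>b k) (x k) (d k)\<close> for the scaled directional
  derivative that governs the line search. Everything follows from two inequalities that
  are uniform in \<open>k\<close>:

    \<^item> the search direction is controlled by the descent it promises, \<open>(norm (d k))\<^sup>2 \<le> C * - D k\<close>;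
    \<^item> the promised descent dominates the steepest descent direction, \<open>c * (norm (v k))\<^sup>2 \<le> - D k\<close>.

  For \<open>k = 0\<close> they are immediate from \<open>d 0 = v 0\<close>. For \<open>k \<ge> 1\<close> both come
  from the subspace subproblem (\<open>subspace_subproblem_estimates\<close>). Its objective is the sum of
  a positively homogeneous and a quadratic term, so at a minimizer the first is
  minus twice the second (\<open>homogeneous_minimizer\<close>), that is \<open>D k = - w \<bullet> (H k *v w)\<close> with
  \<open>w = (\<mu> k, \<nu> k)\<close>. The lower eigenvalue bound on the scaled matrix turns this into the first
  inequality. Testing the minimality with a multiple of \<open>v k\<close> and using the upper
  eigenvalue bound gives the second one.

  The sufficient decrease condition and compactness of the level set force \<open>t k * D k\<close> to vanish.
  If \<open>D k\<close> stayed away from zero along a subsequence, the step lengths \<open>t k\<close> would vanish there, hence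
  so would the steps, because the directions are bounded by the first inequality; uniform
  continuity of the gradients on the level set then contradicts the curvature condition.
  So \<open>D k\<close> tends to zero (\<open>wolfe_descent_Dmax_tendsto_0\<close>), where uniform
  continuity does the work that a Lipschitz constant does in Zoutendijk's theorem. By the
  second inequality \<open>v k\<close> tends to zero. Finally, the optimal value of the direction subproblem is
  \<open>- (norm (v k))\<^sup>2 / 2\<close>; if some direction were a common descent direction at an
  accumulation point, a short step along it would keep these optimal values below a fixed
  negative number, although they tend to zero (\<open>pareto_critical_limit\<close>).\<close>

section \<open>Quadratic forms of symmetric two by two matrices\<close>

lemma eigenvalues_2:
  fixes A :: "real^2^2"
  shows "e \<in> eigenvalues A \<longleftrightarrow> (A$1$1 - e) * (A$2$2 - e) = A$1$2 * A$2$1"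
proof -
  have "e \<in> eigenvalues A \<longleftrightarrow> (\<exists>w. w \<noteq> 0 \<and> (A - mat e) *v w = 0)"
  proof -
    have "(mat e :: real^2^2) *v w = e *\<^sub>R w" for w
      by (simp add: vec_eq_iff matrix_vector_mult_def mat_def if_distrib[of "\<lambda>x. x * _"] cong: if_cong)
    then show ?thesis
      by (simp add: eigenvalues_def matrix_vector_mult_diff_rdistrib)
  qed
  also have "\<dots> \<longleftrightarrow> \<not> invertible (A - mat e)"
    by (metis invertible_left_inverse matrix_left_invertible_ker)
  also have "\<dots> \<longleftrightarrow> det (A - mat e) = 0"
    by (simp add: invertible_det_nz)
  also have "\<dots> \<longleftrightarrow> (A$1$1 - e) * (A$2$2 - e) = A$1$2 * A$2$1"
    by (simp add: det_2 mat_def)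
  finally show ?thesis .
qed

lemma psd_2:
  fixes a b d p q :: real
  assumes "0 \<le> a" "0 \<le> d" "a * d = b\<^sup>2"
  shows "0 \<le> a * p\<^sup>2 + 2 * b * p * q + d * q\<^sup>2"
proof (cases "a = 0")
  case True
  then show ?thesis using assms by simp
next
  case False
  have "a * (a * p\<^sup>2 + 2 * b * p * q + d * q\<^sup>2) = (a * p + b * q)\<^sup>2"
    using assms(3) by (simp add: power2_eq_square) algebra
  then show ?thesis
    using False assms(1) by (metis less_eq_real_def zero_le_mult_iff zero_le_power2 not_less)
qed

text \<open>The roots of the characteristic polynomial are written down explicitly. Subtracting
  an extreme root from the diagonal leaves a semidefinite matrix of determinant zero, which
  gives the Rayleigh bounds; the explicit roots also show that \<open>Min\<close> and \<open>Max\<close> in \<open>lambda_min\<close> and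
  \<open>lambda_max\<close> are taken over a finite nonempty set.\<close>

lemma rayleigh_bounds_2:
  fixes A :: "real^2^2"
  assumes sym: "A$1$2 = A$2$1"
  shows "lambda_min A * (w \<bullet> w) \<le> w \<bullet> (A *v w)" "w \<bullet> (A *v w) \<le> lambda_max A * (w \<bullet> w)"
proof -
  define a b d where abd: "a = A$1$1" "b = A$1$2" "d = A$2$2"
  define r where "r = sqrt ((a - d)\<^sup>2 + 4 * b\<^sup>2)"
  define e1 e2 where e12: "e1 = (a + d - r) / 2" "e2 = (a + d + r) / 2"
  have r: "r\<^sup>2 = (a - d)\<^sup>2 + 4 * b\<^sup>2" "0 \<le> r"
    by (auto simp: r_def)
  have "\<bar>a - d\<bar> \<le> r"
    unfolding r_def by (rule real_le_rsqrt) simp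
  then have order: "e1 \<le> a" "e1 \<le> d" "a \<le> e2" "d \<le> e2" "e1 \<le> e2"
    using r(2) by (auto simp: e12 abs_le_iff)
  have char_poly: "(a - e) * (d - e) - b\<^sup>2 = (e - e1) * (e - e2)" for e
    using r(1) unfolding e12 by (simp add: field_simps power2_eq_square)
  have "eigenvalues A = {e1, e2}"
  proof -
    have "e \<in> eigenvalues A \<longleftrightarrow> (e - e1) * (e - e2) = 0" for e
      using eigenvalues_2[of e A] char_poly[of e] sym by (auto simp: abd power2_eq_square)
    then show ?thesis by auto
  qed
  then have extreme: "lambda_min A = e1" "lambda_max A = e2"
    using order(5) by (auto simp: lambda_min_def lambda_max_def)
  define p q where pq: "p = w$1" "q = w$2"
  have form: "w \<bullet> (A *v w) = a * p\<^sup>2 + 2 * b * p * q + d * q\<^sup>2" "w \<bullet> w = p\<^sup>2 + q\<^sup>2"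
    using sym by (auto simp: inner_vec_def matrix_vector_mult_def sum_2 abd pq
        power2_eq_square algebra_simps)
  have "0 \<le> (a - e1) * p\<^sup>2 + 2 * b * p * q + (d - e1) * q\<^sup>2"
    by (rule psd_2) (use order char_poly[of e1] in auto)
  moreover have "0 \<le> (e2 - a) * p\<^sup>2 + 2 * (- b) * p * q + (e2 - d) * q\<^sup>2"
    by (rule psd_2) (use order char_poly[of e2] in \<open>auto simp: algebra_simps\<close>)
  ultimately show "lambda_min A * (w \<bullet> w) \<le> w \<bullet> (A *v w)" "w \<bullet> (A *v w) \<le> lambda_max A * (w \<bullet> w)"
    by (auto simp: form extreme algebra_simps)
qed

lemma scaling_mult_vec: "scaling v s *v w = vector [norm v * w$1, norm s * w$2]"
  by (simp add: scaling_def mat2_def vec_eq_iff forall_2 matrix_vector_mult_def sum_2)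

lemma invertible_scaling:
  assumes "v \<noteq> 0" "s \<noteq> 0"
  shows "invertible (scaling v s)"
  using assms by (simp add: invertible_det_nz det_2 scaling_def mat2_def)

text \<open>Undoing the scaling recovers the symmetric matrix \<open>L ** transpose L\<close> of the
  factorization, so the eigenvalue bounds are bounds for the quadratic form of the matrix
  itself, measured in the scaled coordinates \<open>(norm v * w$1, norm s * w$2)\<close>.\<close>

lemma hessian_approx_form_bounds:
  fixes v s y :: "real^'n"
  defines "S \<equiv> scaling v s"
  assumes H: "H = hessian_approx c1 c2 v s y \<rho>1 \<rho>2"
    and nz: "v \<noteq> 0" "s \<noteq> 0"
    and lo: "l \<le> lambda_min (matrix_inv S ** H ** matrix_inv S)"
    and up: "lambda_max (matrix_inv S ** H ** matrix_inv S) \<le> u"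
  shows "l * ((norm v * w$1)\<^sup>2 + (norm s * w$2)\<^sup>2) \<le> w \<bullet> (H *v w)"
    "w \<bullet> (H *v w) \<le> u * ((norm v * w$1)\<^sup>2 + (norm s * w$2)\<^sup>2)"
proof -
  obtain L :: "real^2^2" where HL: "H = S ** L ** transpose L ** S"
    using H unfolding hessian_approx_def Let_def S_def by blast
  define M where "M = L ** transpose L"
  have "S ** matrix_inv S = mat 1 \<and> matrix_inv S ** S = mat 1"
    unfolding matrix_inv_def
    using invertible_scaling[OF nz] unfolding S_def invertible_def by (rule someI_ex)
  then have inv: "matrix_inv S ** S = mat 1" "S ** matrix_inv S = mat 1" by auto
  have "matrix_inv S ** H ** matrix_inv S
      = (matrix_inv S ** S) ** M ** (S ** matrix_inv S)"
    by (simp add: HL M_def matrix_mul_assoc)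
  then have M: "matrix_inv S ** H ** matrix_inv S = M"
    by (simp add: inv)
  have "transpose M = M"
    by (simp add: M_def matrix_transpose_mul)
  then have "transpose M $ 2 $ 1 = M$2$1" by simp
  then have sym: "M$1$2 = M$2$1"
    by (simp add: transpose_def)
  define z where "z = S *v w"
  have "w \<bullet> (S *v c) = (S *v w) \<bullet> c" for c
    by (simp add: S_def scaling_mult_vec inner_vec_def sum_2)
  then have form: "w \<bullet> (H *v w) = z \<bullet> (M *v z)"
    by (simp add: HL M_def z_def matrix_vector_mul_assoc[symmetric])
  have zz: "z \<bullet> z = (norm v * w$1)\<^sup>2 + (norm s * w$2)\<^sup>2"
    by (simp add: z_def S_def scaling_mult_vec inner_vec_def sum_2 power2_eq_square)
  have "l * (z \<bullet> z) \<le> lambda_min M * (z \<bullet> z)" "lambda_max M * (z \<bullet> z) \<le> u * (z \<bullet> z)"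
    using lo up by (auto simp: M intro!: mult_right_mono)
  with rayleigh_bounds_2[OF sym, of z]
  show "l * ((norm v * w$1)\<^sup>2 + (norm s * w$2)\<^sup>2) \<le> w \<bullet> (H *v w)"
    "w \<bullet> (H *v w) \<le> u * ((norm v * w$1)\<^sup>2 + (norm s * w$2)\<^sup>2)"
    unfolding form zz by linarith+
qed

section \<open>The scaled directional derivative\<close>

lemma Dmax_le_iff: "Dmax F \<alpha> x d \<le> c \<longleftrightarrow> (\<forall>i. (grad F i x \<bullet> d) / \<alpha>$i \<le> c)"
  unfolding Dmax_def by (subst Max_le_iff) (auto simp: divide_inverse mult.commute)

lemma Dmax_ge: "(grad F i x \<bullet> d) / \<alpha>$i \<le> Dmax F \<alpha> x d"
  using Dmax_le_iff by blast

lemma Dmax_attained: obtains i where "Dmax F \<alpha> x d = (grad F i x \<bullet> d) / \<alpha>$i"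
proof -
  have "Dmax F \<alpha> x d \<in> range (\<lambda>i. (grad F i x /\<^sub>R \<alpha>$i) \<bullet> d)"
    unfolding Dmax_def by (rule Max_in) auto
  then show ?thesis using that by (auto simp: divide_inverse mult.commute)
qed

lemma Dmax_scaleR:
  assumes "0 \<le> c"
  shows "Dmax F \<alpha> x (c *\<^sub>R d) = c * Dmax F \<alpha> x d"
proof (rule antisym)
  show "Dmax F \<alpha> x (c *\<^sub>R d) \<le> c * Dmax F \<alpha> x d"
    unfolding Dmax_le_iff 
  proof
    fix i
    show "(grad F i x \<bullet> (c *\<^sub>R d)) / \<alpha>$i \<le> c * Dmax F \<alpha> x d"
      using mult_left_mono[OF Dmax_ge[of F i x d \<alpha>] assms] by simp
  qed
next
  obtain i where "Dmax F \<alpha> x d = (grad F i x \<bullet> d) / \<alpha>$i" by (rule Dmax_attained)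
  then show "c * Dmax F \<alpha> x d \<le> Dmax F \<alpha> x (c *\<^sub>R d)"
    using Dmax_ge[of F i x "c *\<^sub>R d" \<alpha>] by simp
qed

text \<open>The gradients are stacked into one vector-valued function so that a single norm bounds all
  of them and a single modulus of continuity serves all components.\<close>

definition grad_matrix :: "(real^'n \<Rightarrow> real^'m) \<Rightarrow> real^'n \<Rightarrow> real^'n^'m" where
  "grad_matrix F x = (\<chi> i. grad F i x)"

lemma continuous_on_grad_matrix:
  assumes "continuously_differentiable F"
  shows "continuous_on S (grad_matrix F)"
  using assms unfolding grad_matrix_def continuously_differentiable_def
  by (intro continuous_intros) (auto intro: continuous_on_subset)

lemma Dmax_ge_norm:
  fixes F :: "real^'n \<Rightarrow> real^'m"
  assumes "0 < a" "\<forall>i. a \<le> \<alpha>$i"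
  shows "- Dmax F \<alpha> x d \<le> norm (grad_matrix F x) * norm d / a"
proof -
  obtain i :: 'm where True by simp
  have pos: "0 < \<alpha>$i" using assms by (meson less_le_trans)
  have "norm (grad F i x) \<le> norm (grad_matrix F x)"
    using Finite_Cartesian_Product.norm_nth_le[of "grad_matrix F x" i] by (simp add: grad_matrix_def)
  then have "\<bar>grad F i x \<bullet> d\<bar> \<le> norm (grad_matrix F x) * norm d"
    by (meson Cauchy_Schwarz_ineq2 mult_right_mono norm_ge_zero order_trans)
  then have "- (grad F i x \<bullet> d) / \<alpha>$i \<le> norm (grad_matrix F x) * norm d / a"
    using pos assms by (intro frac_le) auto
  then show ?thesis using Dmax_ge[of F i x d \<alpha>] by simp
qed

lemma Dmax_diff_le_norm:
  fixes F :: "real^'n \<Rightarrow> real^'m"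
  assumes "0 < a" "\<forall>i. a \<le> \<alpha>$i"
  shows "Dmax F \<alpha> z d - Dmax F \<alpha> x d \<le> norm (grad_matrix F z - grad_matrix F x) * norm d / a"
proof -
  obtain i where i: "Dmax F \<alpha> z d = (grad F i z \<bullet> d) / \<alpha>$i" by (rule Dmax_attained)
  have pos: "0 < \<alpha>$i" using assms by (meson less_le_trans)
  have "norm (grad F i z - grad F i x) \<le> norm (grad_matrix F z - grad_matrix F x)"
    using Finite_Cartesian_Product.norm_nth_le[of "grad_matrix F z - grad_matrix F x" i] by (simp add: grad_matrix_def)
  then have "\<bar>(grad F i z - grad F i x) \<bullet> d\<bar> \<le> norm (grad_matrix F z - grad_matrix F x) * norm d"
    by (meson Cauchy_Schwarz_ineq2 mult_right_mono norm_ge_zero order_trans)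
  then have "((grad F i z - grad F i x) \<bullet> d) / \<alpha>$i
      \<le> norm (grad_matrix F z - grad_matrix F x) * norm d / a"
    using pos assms by (intro frac_le) auto
  then show ?thesis
    using Dmax_ge[of F i x d \<alpha>] by (simp add: i inner_diff_left diff_divide_distrib)
qed

section \<open>The two subproblems\<close>

text \<open>Along the ray through a minimizer the objective is \<open>\<tau> * p + \<tau>\<^sup>2 * q\<close>, minimal at \<open>\<tau> = 1\<close>;
  the conclusion is the vanishing of the derivative there.\<close>

lemma homogeneous_minimizer:
  fixes p q :: real
  assumes "\<And>\<tau>. 0 < \<tau> \<Longrightarrow> p + q \<le> \<tau> * p + \<tau>\<^sup>2 * q"
  shows "p = - 2 * q"
proof -
  have "((\<lambda>\<tau>. \<tau> * p + \<tau>\<^sup>2 * q) has_real_derivative (p + 2 * q)) (at 1)"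
    by (auto intro!: derivative_eq_intros)
  moreover have "\<forall>\<tau>. \<bar>1 - \<tau>\<bar> < 1 \<longrightarrow> 1 * p + 1\<^sup>2 * q \<le> \<tau> * p + \<tau>\<^sup>2 * q"
    using assms by auto
  ultimately have "p + 2 * q = 0"
    using DERIV_local_min[of "\<lambda>\<tau>. \<tau> * p + \<tau>\<^sup>2 * q" "p + 2 * q" 1 1] by simp
  then show ?thesis by simp
qed

lemma direction_subproblem_optimal:
  assumes "direction_subproblem F \<alpha> x v lam"
  shows "Dmax F \<alpha> x v = - (norm v)\<^sup>2"
    and "- (norm v)\<^sup>2 / 2 \<le> Dmax F \<alpha> x u + (norm u)\<^sup>2 / 2"
proof -
  have objective: "(MAX i. (grad F i x /\<^sub>R \<alpha>$i) \<bullet> z + (norm z)\<^sup>2 / 2) = Dmax F \<alpha> x z + (norm z)\<^sup>2 / 2"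
    for z
    unfolding Dmax_def by (rule Max_add_commute) auto
  have min: "Dmax F \<alpha> x v + (norm v)\<^sup>2 / 2 \<le> Dmax F \<alpha> x z + (norm z)\<^sup>2 / 2" for z
    using assms unfolding direction_subproblem_def is_arg_min_def objective by (auto simp: not_less)
  have "Dmax F \<alpha> x v = - 2 * ((norm v)\<^sup>2 / 2)"
  proof (rule homogeneous_minimizer)
    fix \<tau> :: real assume "0 < \<tau>"
    then show "Dmax F \<alpha> x v + (norm v)\<^sup>2 / 2 \<le> \<tau> * Dmax F \<alpha> x v + \<tau>\<^sup>2 * ((norm v)\<^sup>2 / 2)"
      using min[of "\<tau> *\<^sub>R v"] by (simp add: Dmax_scaleR power_mult_distrib)
  qed
  then show opt: "Dmax F \<alpha> x v = - (norm v)\<^sup>2" by simp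
  show "- (norm v)\<^sup>2 / 2 \<le> Dmax F \<alpha> x u + (norm u)\<^sup>2 / 2"
    using min[of u] by (simp add: opt)
qed

text \<open>No objective increases along \<open>v\<close> to first order, so all the quotients in \<open>Dmax\<close> have the same
  sign and replacing the scaling factors costs at most the ratio of their bounds. This carries the
  descent of \<open>v\<close> from the scaling of the direction subproblem to that of the subspace
  subproblem.\<close>

lemma Dmax_rescale:
  fixes F :: "real^'n \<Rightarrow> real^'m"
  assumes "Dmax F \<alpha> x v = - (norm v)\<^sup>2" "0 < a"
    and "\<forall>i. a \<le> \<alpha>$i" "\<forall>i. a \<le> \<beta>$i \<and> \<beta>$i \<le> b"
  shows "Dmax F \<beta> x v \<le> - (a / b) * (norm v)\<^sup>2"
  unfolding Dmax_le_iff
proof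
  fix i
  have pos: "0 < \<alpha>$i" "0 < \<beta>$i" using assms by (meson less_le_trans)+
  have "(grad F i x \<bullet> v) / \<alpha>$i \<le> - (norm v)\<^sup>2"
    using Dmax_ge[of F i x v \<alpha>] assms(1) by simp
  then have "\<alpha>$i * (norm v)\<^sup>2 \<le> - (grad F i x \<bullet> v)"
    using pos by (simp add: field_simps)
  moreover have "a * (norm v)\<^sup>2 \<le> \<alpha>$i * (norm v)\<^sup>2"
    using assms(3) by (simp add: mult_right_mono)
  ultimately have "a * (norm v)\<^sup>2 / b \<le> - (grad F i x \<bullet> v) / \<beta>$i"
    using assms pos mult_nonneg_nonneg[of a "(norm v)\<^sup>2"] by (intro frac_le) (auto simp del: mult_nonneg_nonneg)
  then show "(grad F i x \<bullet> v) / \<beta>$i \<le> - (a / b) * (norm v)\<^sup>2" by simp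
qed

text \<open>The first estimate is the optimality identity of the subproblem read through the
  lower bound of the quadratic form. The second compares with the candidate \<open>(r / u, 0)\<close>, which minimizes the
  upper bound \<open>\<tau> * (- r * (norm v)\<^sup>2) + \<tau>\<^sup>2 * u * (norm v)\<^sup>2 / 2\<close> of the objective on
  the ray of nonnegative multiples of \<open>v\<close>.\<close>

lemma subspace_subproblem_estimates:
  fixes F :: "real^'n \<Rightarrow> real^'m"
  assumes sub: "subspace_subproblem F \<beta> x v s H \<mu> \<nu> lam"
    and d: "d = \<mu> *\<^sub>R v + \<nu> *\<^sub>R s"
    and lu: "0 < l" "0 < u" and r: "0 < r"
    and lower: "\<And>w. l * ((norm v * w$1)\<^sup>2 + (norm s * w$2)\<^sup>2) \<le> w \<bullet> (H *v w)"
    and upper: "\<And>w. w \<bullet> (H *v w) \<le> u * ((norm v * w$1)\<^sup>2 + (norm s * w$2)\<^sup>2)"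
    and desc: "Dmax F \<beta> x v \<le> - r * (norm v)\<^sup>2"
  shows "(norm d)\<^sup>2 \<le> 2 / l * - Dmax F \<beta> x d" "r\<^sup>2 / u * (norm v)\<^sup>2 \<le> - Dmax F \<beta> x d"
proof -
  define P where "P w = Dmax F \<beta> x (w$1 *\<^sub>R v + w$2 *\<^sub>R s)" for w :: "real^2"
  define Q where "Q w = w \<bullet> (H *v w)" for w :: "real^2"
  define w where "w = (vector [\<mu>, \<nu>] :: real^2)"
  have objective: "(MAX i. z$1 * ((grad F i x /\<^sub>R \<beta>$i) \<bullet> v) + z$2 * ((grad F i x /\<^sub>R \<beta>$i) \<bullet> s)) = P z"
    for z
    by (simp add: P_def Dmax_def inner_add_right algebra_simps)
  have min: "P w + Q w / 2 \<le> P z + Q z / 2" for z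
    using sub unfolding subspace_subproblem_def Let_def objective is_arg_min_def
    by (auto simp: not_less Q_def w_def)
  have Pd: "P w = Dmax F \<beta> x d"
    by (simp add: P_def w_def d)
  have "P w = - 2 * (Q w / 2)"
  proof (rule homogeneous_minimizer)
    fix \<tau> :: real assume "0 < \<tau>"
    then have "P (\<tau> *\<^sub>R w) = \<tau> * P w"
      unfolding P_def by (subst Dmax_scaleR[symmetric]) (auto simp: scaleR_add_right)
    moreover have "Q (\<tau> *\<^sub>R w) = \<tau>\<^sup>2 * Q w"
      by (simp add: Q_def matrix_vector_mult_scaleR power2_eq_square)
    ultimately show "P w + Q w / 2 \<le> \<tau> * P w + \<tau>\<^sup>2 * (Q w / 2)"
      using min[of "\<tau> *\<^sub>R w"] by simp
  qed
  then have PQ: "Dmax F \<beta> x d = - Q w" by (simp add: Pd)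

  have "norm d \<le> \<bar>\<mu>\<bar> * norm v + \<bar>\<nu>\<bar> * norm s"
    unfolding d by (rule order_trans[OF norm_triangle_ineq]) simp
  then have "(norm d)\<^sup>2 \<le> (\<bar>\<mu>\<bar> * norm v + \<bar>\<nu>\<bar> * norm s)\<^sup>2"
    by (simp add: power_mono)
  also have "\<dots> \<le> 2 * ((\<bar>\<mu>\<bar> * norm v)\<^sup>2 + (\<bar>\<nu>\<bar> * norm s)\<^sup>2)"
    using sum_squares_bound[of "\<bar>\<mu>\<bar> * norm v" "\<bar>\<nu>\<bar> * norm s"] by (simp add: power2_sum)
  also have "\<dots> = 2 * ((norm v * w$1)\<^sup>2 + (norm s * w$2)\<^sup>2)"
    by (simp add: w_def power_mult_distrib mult.commute)
  also have "\<dots> \<le> 2 / l * Q w"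
    using lower[of w] lu by (simp add: Q_def field_simps)
  finally show "(norm d)\<^sup>2 \<le> 2 / l * - Dmax F \<beta> x d" by (simp add: PQ)

  define z where "z = (vector [r / u, 0] :: real^2)"
  have "P z \<le> r / u * (- r * (norm v)\<^sup>2)"
    using mult_left_mono[OF desc, of "r / u"] lu r by (simp add: P_def z_def Dmax_scaleR)
  moreover have "Q z \<le> u * (norm v * (r / u))\<^sup>2"
    using upper[of z] by (simp add: Q_def z_def)
  moreover have "u * (norm v * (r / u))\<^sup>2 = r\<^sup>2 / u * (norm v)\<^sup>2"
    using lu by (simp add: field_simps power2_eq_square)
  moreover have "r / u * (- r * (norm v)\<^sup>2) = - (r\<^sup>2 / u * (norm v)\<^sup>2)"
    by (simp add: power2_eq_square)
  ultimately show "r\<^sup>2 / u * (norm v)\<^sup>2 \<le> - Dmax F \<beta> x d"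
    using min[of z] PQ Pd by linarith
qed

section \<open>Descent under the Wolfe conditions\<close>

lemma wolfe_decrease:
  fixes F :: "real^'n \<Rightarrow> real^'m"
  assumes "0 < a" "0 < \<sigma>1" "a \<le> \<beta>$i" "0 < t" "Dmax F \<beta> x d \<le> 0" "wolfe F \<sigma>1 \<sigma>2 \<beta> x d t"
  shows "a * \<sigma>1 * (t * - Dmax F \<beta> x d) \<le> F x $ i - F (x + t *\<^sub>R d) $ i"
proof -
  define \<delta> where "\<delta> = \<sigma>1 * (t * - Dmax F \<beta> x d)"
  have pos: "0 < \<beta>$i" using assms by linarith
  have "(F (x + t *\<^sub>R d) $ i - F x $ i) / \<beta>$i \<le> - \<delta>"
    using assms(6) by (simp add: wolfe_def \<delta>_def mult.assoc)
  then have "\<beta>$i * \<delta> \<le> F x $ i - F (x + t *\<^sub>R d) $ i"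
    using pos by (simp add: field_simps)
  moreover have "a * \<delta> \<le> \<beta>$i * \<delta>"
    using assms by (intro mult_right_mono) (auto simp: \<delta>_def intro!: mult_nonneg_nonneg mult_nonneg_nonpos)
  ultimately show ?thesis by (simp add: \<delta>_def mult.assoc)
qed

lemma wolfe_descent_level_set:
  fixes F :: "real^'n \<Rightarrow> real^'m"
  assumes "0 < a" "0 < \<sigma>1" "\<And>k i. a \<le> \<beta> k $ i" "\<And>k. 0 < t k"
    and "\<And>k. Dmax F (\<beta> k) (x k) (d k) \<le> 0"
    and "\<And>k. wolfe F \<sigma>1 \<sigma>2 (\<beta> k) (x k) (d k) (t k)"
    and "\<And>k. x (Suc k) = x k + t k *\<^sub>R d k"
  shows "x k \<in> level_set F (x 0)"
proof (induction k)
  case 0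
  then show ?case by (simp add: level_set_def)
next
  case (Suc k)
  have "F (x (Suc k)) $ i \<le> F (x k) $ i" for i
  proof -
    have "0 \<le> a * \<sigma>1 * (t k * - Dmax F (\<beta> k) (x k) (d k))"
      using assms(1,2) assms(4,5)[of k] by (intro mult_nonneg_nonneg) auto
    also have "\<dots> \<le> F (x k) $ i - F (x (Suc k)) $ i"
      unfolding assms(7) by (rule wolfe_decrease) (use assms in auto)
    finally show ?thesis by simp
  qed
  with Suc show ?case by (auto simp: level_set_def intro: order_trans)
qed

text \<open>The method enters only through the last hypothesis: \<open>d\<close> may be any sequence of directions
  controlled by the descent that it promises. Since \<open>Dmax\<close> is at most linear in the direction, this
  already bounds \<open>d\<close>. The sufficient decrease condition makes \<open>t k * Dmax F (\<beta> k) (x k) (d k)\<close>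
  vanish, so an iteration with large promised descent has a short step; but then the gradients
  hardly change over the step, and the curvature condition fails.\<close>

lemma wolfe_descent_Dmax_tendsto_0:
  fixes F :: "real^'n \<Rightarrow> real^'m"
  assumes F: "continuously_differentiable F"
    and compact: "compact (level_set F (x 0))"
    and a: "0 < a" "\<And>k i. a \<le> \<beta> k $ i"
    and \<sigma>: "0 < \<sigma>1" "\<sigma>2 < 1"
    and t: "\<And>k. 0 < t k"
    and desc: "\<And>k. Dmax F (\<beta> k) (x k) (d k) \<le> 0"
    and wolfe: "\<And>k. wolfe F \<sigma>1 \<sigma>2 (\<beta> k) (x k) (d k) (t k)"
    and next_x: "\<And>k. x (Suc k) = x k + t k *\<^sub>R d k"
    and C: "0 < C" "\<And>k. (norm (d k))\<^sup>2 \<le> C * - Dmax F (\<beta> k) (x k) (d k)"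
  shows "(\<lambda>k. Dmax F (\<beta> k) (x k) (d k)) \<longlonglongrightarrow> 0"
proof -
  define \<Delta> where "\<Delta> k = - Dmax F (\<beta> k) (x k) (d k)" for k
  define K where "K = level_set F (x 0)"
  have \<Delta>_nonneg: "0 \<le> \<Delta> k" for k
    using desc[of k] by (simp add: \<Delta>_def)
  have in_K: "x k \<in> K" for k
    unfolding K_def
    by (rule wolfe_descent_level_set[where \<beta> = \<beta> and d = d and t = t,
          OF a(1) \<sigma>(1) a(2) t desc wolfe next_x])

  have t\<Delta>: "(\<lambda>k. t k * \<Delta> k) \<longlonglongrightarrow> 0"
  proof -
    obtain i :: 'm where True by simp
    define f where "f k = F (x k) $ i" for k
    have decrease: "a * \<sigma>1 * (t k * \<Delta> k) \<le> f k - f (Suc k)" for k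
      unfolding f_def next_x \<Delta>_def by (rule wolfe_decrease) (use a \<sigma> t desc wolfe in auto)
    have "0 \<le> a * \<sigma>1 * (t k * \<Delta> k)" for k
      using a \<sigma> t[of k] \<Delta>_nonneg[of k] by simp
    then have "decseq f"
      using decrease unfolding decseq_Suc_iff by (meson diff_ge_0_iff_ge order_trans)
    have "continuous_on K F"
      using F unfolding continuously_differentiable_def
      by (meson continuous_at_imp_continuous_on differentiable_imp_continuous_within)
    then have "bounded ((\<lambda>z. F z $ i) ` K)"
      using compact by (intro compact_imp_bounded compact_continuous_image continuous_intros)
        (auto simp: K_def)
    then obtain B where "\<And>z. z \<in> K \<Longrightarrow> \<bar>F z $ i\<bar> \<le> B"
      unfolding bounded_iff by auto
    then have "- B \<le> f k" for k
      using in_K[of k] by (force simp: f_def abs_le_iff)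
    then obtain l where l: "f \<longlonglongrightarrow> l"
      using decseq_convergent[OF \<open>decseq f\<close>] by blast
    then have "(\<lambda>k. (f k - f (Suc k)) / (a * \<sigma>1)) \<longlonglongrightarrow> (l - l) / (a * \<sigma>1)"
      using a \<sigma> by (intro tendsto_intros LIMSEQ_Suc) auto
    then have lim: "(\<lambda>k. (f k - f (Suc k)) / (a * \<sigma>1)) \<longlonglongrightarrow> 0" by simp
    show ?thesis
    proof (rule tendsto_sandwich[OF _ _ tendsto_const lim])
      show "\<forall>\<^sub>F k in sequentially. 0 \<le> t k * \<Delta> k"
        using t \<Delta>_nonneg by (simp add: less_imp_le)
      show "\<forall>\<^sub>F k in sequentially. t k * \<Delta> k \<le> (f k - f (Suc k)) / (a * \<sigma>1)"
        using decrease a \<sigma> by (simp add: pos_le_divide_eq mult.commute)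
    qed
  qed

  obtain G where G: "0 < G" "\<And>z. z \<in> K \<Longrightarrow> norm (grad_matrix F z) \<le> G"
  proof -
    have "bounded (grad_matrix F ` K)"
      using compact continuous_on_grad_matrix[OF F]
      by (intro compact_imp_bounded compact_continuous_image) (auto simp: K_def)
    then show ?thesis using that unfolding bounded_pos by auto
  qed
  define R where "R = C * (G / a)"
  have R: "0 < R" using C G a by (simp add: R_def)
  have d_le: "norm (d k) \<le> R" for k
  proof -
    have "\<Delta> k \<le> norm (grad_matrix F (x k)) * norm (d k) / a"
      unfolding \<Delta>_def by (rule Dmax_ge_norm) (use a in auto)
    also have "\<dots> \<le> G * norm (d k) / a"
      using G(2)[OF in_K] a by (intro divide_right_mono mult_right_mono) auto
    finally have "C * \<Delta> k \<le> C * (G * norm (d k) / a)"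
      using C by (intro mult_left_mono) auto
    then have "norm (d k) * norm (d k) \<le> R * norm (d k)"
      using C(2)[of k] by (simp add: \<Delta>_def R_def power2_eq_square)
    then show ?thesis
      using R by (cases "d k = 0") auto
  qed

  have "\<Delta> \<longlonglongrightarrow> 0"
  proof (rule LIMSEQ_I)
    fix e :: real assume e: "0 < e"
    \<comment> \<open>a change of the gradients below this bound makes the derivative change by less than the
      curvature condition demands when \<open>\<Delta> k \<ge> e\<close>\<close>
    define \<eta> where "\<eta> = (1 - \<sigma>2) * e * a / R"
    have "0 < \<eta>" using e \<sigma> a R by (simp add: \<eta>_def)
    have "uniformly_continuous_on K (grad_matrix F)"
      using compact continuous_on_grad_matrix[OF F] by (auto simp: K_def intro: compact_uniformly_continuous)
    then obtain \<delta> where \<delta>: "0 < \<delta>"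
      "\<And>y z. y \<in> K \<Longrightarrow> z \<in> K \<Longrightarrow> dist z y < \<delta> \<Longrightarrow> dist (grad_matrix F z) (grad_matrix F y) < \<eta>"
      using \<open>0 < \<eta>\<close> unfolding uniformly_continuous_on_def by metis
    \<comment> \<open>small enough to force a step shorter than \<open>\<delta>\<close> when \<open>\<Delta> k \<ge> e\<close>\<close>
    have "0 < \<delta> / R * e" using \<delta> R e by simp
    then obtain N where N: "\<And>k. k \<ge> N \<Longrightarrow> t k * \<Delta> k < \<delta> / R * e"
      using LIMSEQ_D[OF t\<Delta>] by (metis abs_ge_self diff_zero le_less_trans real_norm_def)
    have "\<Delta> k < e" if "k \<ge> N" for k
    proof (rule ccontr)
      assume "\<not> \<Delta> k < e"
      then have "t k * e \<le> t k * \<Delta> k"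
        using t[of k] by simp
      with N[OF that] have "t k * e < \<delta> / R * e" by linarith
      then have "t k < \<delta> / R" by (rule mult_right_less_imp_less) (use e in simp)
      then have "t k * R < \<delta>" using R by (simp add: pos_less_divide_eq)
      moreover have "dist (x (Suc k)) (x k) \<le> t k * R"
        using t[of k] d_le[of k] by (simp add: next_x dist_norm)
      ultimately have "dist (x (Suc k)) (x k) < \<delta>" by linarith
      then have small: "norm (grad_matrix F (x (Suc k)) - grad_matrix F (x k)) < \<eta>"
        using \<delta>(2)[OF in_K in_K] by (simp add: dist_norm)
      have "(1 - \<sigma>2) * \<Delta> k \<le> Dmax F (\<beta> k) (x (Suc k)) (d k) - Dmax F (\<beta> k) (x k) (d k)"
        using wolfe[of k] by (simp add: wolfe_def next_x \<Delta>_def algebra_simps)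
      also have "\<dots> \<le> norm (grad_matrix F (x (Suc k)) - grad_matrix F (x k)) * norm (d k) / a"
        by (rule Dmax_diff_le_norm) (use a in auto)
      also have "\<dots> \<le> norm (grad_matrix F (x (Suc k)) - grad_matrix F (x k)) * R / a"
        using d_le[of k] a by (intro divide_right_mono mult_left_mono) auto
      also have "\<dots> < \<eta> * R / a"
        using small R a by (intro divide_strict_right_mono mult_strict_right_mono) auto
      also have "\<dots> = (1 - \<sigma>2) * e"
        using R a by (simp add: \<eta>_def)
      finally show False
        using \<open>\<not> \<Delta> k < e\<close> \<sigma> by simp
    qed
    then show "\<exists>N. \<forall>k\<ge>N. norm (\<Delta> k - 0) < e"
      using \<Delta>_nonneg by auto
  qed
  then show ?thesis
    using tendsto_minus[of \<Delta> 0] by (simp add: \<Delta>_def)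
qed

section \<open>Criticality of limits\<close>

text \<open>A common descent direction \<open>u\<close> at the limit remains one, with a uniform rate, at nearby
  iterates. The comparison point \<open>\<tau> *\<^sub>R u\<close> with small \<open>\<tau>\<close> then bounds the optimal values of the
  direction subproblems away from zero, whereas they equal \<open>- (norm (v k))\<^sup>2 / 2\<close>.\<close>

lemma pareto_critical_limit:
  fixes F :: "real^'n \<Rightarrow> real^'m"
  assumes F: "continuously_differentiable F"
    and z: "z \<longlonglongrightarrow> l"
    and v: "v \<longlonglongrightarrow> 0"
    and \<alpha>: "\<And>k i. 0 < \<alpha> k $ i" "\<And>k i. \<alpha> k $ i \<le> b"
    and sub: "\<And>k. direction_subproblem F (\<alpha> k) (z k) (v k) (lam k)"
  shows "pareto_critical F l"
  unfolding pareto_critical_def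
proof
  assume "\<exists>u. \<forall>i. grad F i l \<bullet> u < 0"
  then obtain u where u: "\<And>i. grad F i l \<bullet> u < 0" by blast
  define \<epsilon> where "\<epsilon> = - (MAX i. grad F i l \<bullet> u) / 2"
  have "grad F i l \<bullet> u \<le> (MAX i. grad F i l \<bullet> u)" for i
    by (rule Max_ge) auto
  moreover have "(MAX i. grad F i l \<bullet> u) = - 2 * \<epsilon>"
    unfolding \<epsilon>_def by linarith
  ultimately have le_eps: "grad F i l \<bullet> u \<le> - 2 * \<epsilon>" for i
    by metis
  have "(MAX i. grad F i l \<bullet> u) < 0"
    using u by (subst Max_less_iff) auto
  then have \<epsilon>: "0 < \<epsilon>"
    unfolding \<epsilon>_def by linarith
  have b: "0 < b" using \<alpha> by (meson less_le_trans)
  have "\<forall>\<^sub>F k in sequentially. \<forall>i. grad F i (z k) \<bullet> u < - \<epsilon>"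
  proof (rule eventually_all_finite)
    fix i
    have "continuous_on UNIV (grad F i)"
      using F by (simp add: continuously_differentiable_def)
    then have "(\<lambda>k. grad F i (z k)) \<longlonglongrightarrow> grad F i l"
      using z by (simp add: continuous_on_eq_continuous_at isCont_tendsto_compose)
    then have "(\<lambda>k. grad F i (z k) \<bullet> u) \<longlonglongrightarrow> grad F i l \<bullet> u"
      by (intro tendsto_intros)
    moreover have "grad F i l \<bullet> u < - \<epsilon>" using le_eps[of i] \<epsilon> by simp
    ultimately show "\<forall>\<^sub>F k in sequentially. grad F i (z k) \<bullet> u < - \<epsilon>"
      by (rule order_tendstoD)
  qed
  then have "\<forall>\<^sub>F k in sequentially. Dmax F (\<alpha> k) (z k) u \<le> - \<epsilon> / b"
  proof eventually_elim
    case (elim k)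
    have "\<epsilon> / b \<le> - (grad F i (z k) \<bullet> u) / \<alpha> k $ i" for i
      using elim[rule_format, of i] \<alpha>(1)[of k i] \<alpha>(2)[of k i] \<epsilon> by (intro frac_le) auto
    then show ?case unfolding Dmax_le_iff by (simp add: le_minus_iff minus_le_iff)
  qed
  then have bound: "\<forall>\<^sub>F k in sequentially. - (norm (v k))\<^sup>2 / 2 \<le> \<tau> * (- \<epsilon> / b) + \<tau>\<^sup>2 * (norm u)\<^sup>2 / 2"
    if "0 < \<tau>" for \<tau>
  proof eventually_elim
    case (elim k)
    have "- (norm (v k))\<^sup>2 / 2 \<le> \<tau> * Dmax F (\<alpha> k) (z k) u + \<tau>\<^sup>2 * (norm u)\<^sup>2 / 2"
      using direction_subproblem_optimal(2)[OF sub, of k "\<tau> *\<^sub>R u"] that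
      by (simp add: Dmax_scaleR power_mult_distrib)
    then show ?case using mult_left_mono[OF elim, of \<tau>] that by linarith
  qed
  have "(\<lambda>k. - (norm (v k))\<^sup>2 / 2) \<longlonglongrightarrow> - (norm (0 :: real^'n))\<^sup>2 / 2"
    using v by (intro tendsto_intros) auto
  then have lim: "(\<lambda>k. - (norm (v k))\<^sup>2 / 2) \<longlonglongrightarrow> 0" by simp
  have limit: "0 \<le> \<tau> * (- \<epsilon> / b) + \<tau>\<^sup>2 * (norm u)\<^sup>2 / 2" if "0 < \<tau>" for \<tau>
    by (rule tendsto_upperbound[OF lim bound[OF that]]) simp
  have un: "0 < (norm u)\<^sup>2"
    using u[of undefined] by auto
  \<comment> \<open>the minimizer of the right-hand side of \<open>limit\<close>\<close>
  define \<tau> where "\<tau> = \<epsilon> / (b * (norm u)\<^sup>2)"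
  have "0 < \<tau>" using \<epsilon> b un by (simp add: \<tau>_def)
  moreover have "\<tau>\<^sup>2 * (norm u)\<^sup>2 = \<tau> * (\<epsilon> / b)"
    using b un by (simp add: \<tau>_def power2_eq_square)
  moreover have "0 < \<tau> * (\<epsilon> / b)" using \<open>0 < \<tau>\<close> \<epsilon> b by simp
  moreover have "\<tau> * (- \<epsilon> / b) = - (\<tau> * (\<epsilon> / b))" by simp
  ultimately show False using limit[of \<tau>] by linarith
qed

section \<open>Convergence of the method\<close>

lemma bb_alpha_bounds:
  assumes "\<alpha>min \<le> \<alpha>max"
  shows "\<alpha>min \<le> bb_alpha \<alpha>min \<alpha>max s y" "bb_alpha \<alpha>min \<alpha>max s y \<le> \<alpha>max"
  using assms by (auto simp: bb_alpha_def)

lemma bb_alpha_bar_bounds: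
  assumes "\<alpha>min \<le> \<alpha>max"
  shows "\<alpha>min \<le> bb_alpha_bar \<alpha>min \<alpha>max \<rho> y s yi" "bb_alpha_bar \<alpha>min \<alpha>max \<rho> y s yi \<le> \<alpha>max"
  using assms by (auto simp: bb_alpha_bar_def)

theorem theorem4p1:
  fixes F :: "real^'n \<Rightarrow> real^'m"
    and c1 c2 \<sigma>1 \<sigma>2 \<alpha>min \<alpha>max :: real
    and xm1 :: "real^'n"
    and x v d :: "nat \<Rightarrow> real^'n"
    and \<alpha> \<alpha>b lam lamb :: "nat \<Rightarrow> real^'m"
    and H :: "nat \<Rightarrow> real^2^2"
    and \<mu> \<nu> t :: "nat \<Rightarrow> real"
  assumes "continuously_differentiable F"
    and "\<forall>x0. compact (level_set F x0)"
    and "0 < c1" "c1 \<le> c2"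
    and "0 < \<sigma>1" "\<sigma>1 \<le> \<sigma>2" "\<sigma>2 < 1"
    and "0 < \<alpha>min" "\<alpha>min < \<alpha>max"
    and "smbbmo F c1 c2 \<sigma>1 \<sigma>2 \<alpha>min \<alpha>max xm1 x \<alpha> v lam H \<alpha>b \<mu> \<nu> lamb d t"
    and "\<forall>k\<ge>1.
           c1 \<le> lambda_min (matrix_inv (scaling (v k) (step xm1 x k)) ** H k
                             ** matrix_inv (scaling (v k) (step xm1 x k))) \<and>
           lambda_max (matrix_inv (scaling (v k) (step xm1 x k)) ** H k
                             ** matrix_inv (scaling (v k) (step xm1 x k))) \<le> c2"
    and "\<forall>k. \<not> pareto_critical F (x k)"
  shows "(\<exists>xs. accumulation_point x xs) \<and>
         (\<forall>xs. accumulation_point x xs \<longrightarrow> xs \<in> level_set F (x 0) \<and> pareto_critical F xs)"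
proof -
  note run = assms(10)[unfolded smbbmo_def Let_def]
  note F = assms(1)
  have "\<alpha>min \<le> \<alpha>max" using assms(9) by simp
  note bounds = bb_alpha_bounds[OF this] bb_alpha_bar_bounds[OF this]
  have \<alpha>: "\<alpha>min \<le> \<alpha> k $ i" "\<alpha> k $ i \<le> \<alpha>max" for k i
    using run by (auto simp: bounds)
  have \<alpha>b: "\<alpha>min \<le> \<alpha>b k $ i" "\<alpha>b k $ i \<le> \<alpha>max" for k i
  proof -
    have "\<alpha>min \<le> \<alpha>b k $ i \<and> \<alpha>b k $ i \<le> \<alpha>max"
    proof (cases "k = 0")
      case True
      then show ?thesis using run \<alpha>[of 0 i] by simp
    next
      case False
      then have "k \<ge> 1" by simp
      then obtain \<rho> y s where
        "\<alpha>b k = (\<chi> i. bb_alpha_bar \<alpha>min \<alpha>max \<rho> y s (grad F i (x k) - grad F i (x (k - 1))))"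
        using run by blast
      then show ?thesis by (simp add: bounds)
    qed
    then show "\<alpha>min \<le> \<alpha>b k $ i" "\<alpha>b k $ i \<le> \<alpha>max" by auto
  qed
  have sub: "direction_subproblem F (\<alpha> k) (x k) (v k) (lam k)" and v_nz: "v k \<noteq> 0" for k
    using run by auto
  have t: "0 < t k" and wolfe: "wolfe F \<sigma>1 \<sigma>2 (\<alpha>b k) (x k) (d k) (t k)"
    and next_x: "x (Suc k) = x k + t k *\<^sub>R d k" for k
    using run by auto

  define r where "r = \<alpha>min / \<alpha>max"
  have r: "0 < r" using assms(8,9) by (simp add: r_def)
  define D where "D k = Dmax F (\<alpha>b k) (x k) (d k)" for k
  \<comment> \<open>The \<open>1\<close> in both constants accounts for the first iteration, where \<open>d 0 = v 0\<close>.\<close>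
  define C where "C = max 1 (2 / c1)"
  define c where "c = min 1 (r\<^sup>2 / c2)"
  have C: "0 < C" and c: "0 < c"
    using assms(3,4) r by (auto simp: C_def c_def)

  have later: "(norm (d k))\<^sup>2 \<le> C * - D k \<and> c * (norm (v k))\<^sup>2 \<le> - D k"
    if k: "k \<ge> 1" and s: "step xm1 x k \<noteq> 0" for k
  proof -
    obtain y \<rho>1 \<rho>2 where H: "H k = hessian_approx c1 c2 (v k) (step xm1 x k) y \<rho>1 \<rho>2"
      using run k by blast
    have prob: "subspace_subproblem F (\<alpha>b k) (x k) (v k) (step xm1 x k) (H k) (\<mu> k) (\<nu> k) (lamb k)"
      and d: "d k = \<mu> k *\<^sub>R v k + \<nu> k *\<^sub>R step xm1 x k"
      using run k by blast+
    note forms = hessian_approx_form_bounds[OF H v_nz s, of c1 c2]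
    have desc: "Dmax F (\<alpha>b k) (x k) (v k) \<le> - r * (norm (v k))\<^sup>2"
      unfolding r_def
      by (rule Dmax_rescale[OF direction_subproblem_optimal(1)[OF sub]]) (use assms(8) \<alpha> \<alpha>b in auto)
    have est: "(norm (d k))\<^sup>2 \<le> 2 / c1 * - D k" "r\<^sup>2 / c2 * (norm (v k))\<^sup>2 \<le> - D k"
      using subspace_subproblem_estimates[OF prob d _ _ r forms desc] assms(3,4,11) k
      by (auto simp: D_def)
    have "0 \<le> r\<^sup>2 / c2 * (norm (v k))\<^sup>2" using assms(3,4) by simp
    then have "0 \<le> - D k" using est(2) by linarith
    then have "2 / c1 * - D k \<le> C * - D k"
      by (intro mult_right_mono) (auto simp: C_def)
    moreover have "c * (norm (v k))\<^sup>2 \<le> r\<^sup>2 / c2 * (norm (v k))\<^sup>2"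
      by (intro mult_right_mono) (auto simp: c_def)
    ultimately show ?thesis using est by linarith
  qed
  \<comment> \<open>Induction is needed because the scaling matrix of an iteration is invertible only
    if the previous step was nonzero.\<close>
  have est: "(norm (d k))\<^sup>2 \<le> C * - D k \<and> c * (norm (v k))\<^sup>2 \<le> - D k" for k
  proof (induction k)
    case 0
    have "D 0 = - (norm (v 0))\<^sup>2" "d 0 = v 0"
      using direction_subproblem_optimal(1)[OF sub, of 0] run by (auto simp: D_def)
    moreover have "1 * (norm (v 0))\<^sup>2 \<le> C * (norm (v 0))\<^sup>2" "c * (norm (v 0))\<^sup>2 \<le> 1 * (norm (v 0))\<^sup>2"
      by (intro mult_right_mono; simp add: C_def c_def)+
    ultimately show ?case by simp
  next
    case (Suc k)
    have "0 < c * (norm (v k))\<^sup>2" using c v_nz by simp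
    with Suc have "D k < 0" by linarith
    then have "d k \<noteq> 0"
      using Dmax_scaleR[of 0 F "\<alpha>b k" "x k" 0] by (auto simp: D_def)
    then have "step xm1 x (Suc k) \<noteq> 0"
      using t[of k] by (simp add: step_def prev_def next_x)
    then show ?case by (intro later) auto
  qed
  have D_nonpos: "D k \<le> 0" for k
  proof -
    have "0 \<le> c * (norm (v k))\<^sup>2" using c by simp
    with est[of k] show ?thesis by linarith
  qed

  have compact: "compact (level_set F (x 0))" using assms(2) by blast
  have level: "x k \<in> level_set F (x 0)" for k
    by (rule wolfe_descent_level_set[where \<beta> = \<alpha>b and d = d and t = t,
          OF assms(8) assms(5) \<alpha>b(1) t D_nonpos[unfolded D_def] wolfe next_x])
  have "D \<longlonglongrightarrow> 0"
    unfolding D_def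
    by (rule wolfe_descent_Dmax_tendsto_0[where \<beta> = \<alpha>b and x = x and d = d and t = t,
          OF F compact assms(8) \<alpha>b(1) assms(5,7) t
          D_nonpos[unfolded D_def] wolfe next_x C est[THEN conjunct1, unfolded D_def]])
  then have lim: "(\<lambda>k. - D k / c) \<longlonglongrightarrow> 0"
    using tendsto_divide[OF tendsto_minus[of D 0] tendsto_const[of c]] c by simp
  have "(\<lambda>k. (norm (v k))\<^sup>2) \<longlonglongrightarrow> 0"
  proof (rule tendsto_sandwich[OF _ _ tendsto_const lim])
    show "\<forall>\<^sub>F k in sequentially. (norm (v k))\<^sup>2 \<le> - D k / c"
    proof (intro always_eventually allI)
      show "(norm (v k))\<^sup>2 \<le> - D k / c" for k
        unfolding pos_le_divide_eq[OF c] using est[of k] by (simp add: mult.commute)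
    qed
  qed auto
  then have "(\<lambda>k. norm (v k)) \<longlonglongrightarrow> 0"
    using tendsto_real_sqrt by fastforce
  then have v: "v \<longlonglongrightarrow> 0"
    by (rule tendsto_norm_zero_cancel)

  have "\<exists>xs. accumulation_point x xs"
    using compact level unfolding compact_def accumulation_point_def by blast
  moreover have "xs \<in> level_set F (x 0) \<and> pareto_critical F xs" if acc: "accumulation_point x xs" for xs
  proof
    obtain q :: "nat \<Rightarrow> nat" where q: "strict_mono q" "(x \<circ> q) \<longlonglongrightarrow> xs"
      using acc unfolding accumulation_point_def by blast
    show "xs \<in> level_set F (x 0)"
      using closed_sequentially[OF compact_imp_closed[OF compact] _ q(2)] level by simp
    show "pareto_critical F xs"
    proof (rule pareto_critical_limit[OF F q(2)])
      show "(v \<circ> q) \<longlonglongrightarrow> 0" using v q(1) by (rule LIMSEQ_subseq_LIMSEQ)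
      show "0 < (\<alpha> \<circ> q) k $ i" for k i using assms(8) \<alpha>(1)[of "q k" i] by simp
      show "(\<alpha> \<circ> q) k $ i \<le> \<alpha>max" for k i by (simp add: \<alpha>)
      show "direction_subproblem F ((\<alpha> \<circ> q) k) ((x \<circ> q) k) ((v \<circ> q) k) ((lam \<circ> q) k)" for k
        by (simp add: sub)
    qed
  qed
  ultimately show ?thesis by blast
qed

end
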